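(* Let $P$ be the transition matrix of an ergodic (not necessarily reversible) discrete-time Markov chain $X$ on $\{0,1,\ldots,n\}$ with stationary distribution $\pi$, such that $P^t(0,0)$ is nonincreasing in $t$. Let $P_{\mathrm{abs}}$, $\hat\pi_0$, $\widehat P$, $\Lambda$ be as defined in the context. Then the quasi-link $\Lambda$ provides a quasi-intertwining of $(\pi,P_{\mathrm{abs}})$ and $(\hat\pi_0,\widehat P)$, i.e. each row of $\Lambda$ sums to $1$, $\Lambda P_{\mathrm{abs}}=\widehat P\Lambda$, and $\pi=\hat\pi_0\Lambda$; moreover $\Lambda$ satisfies $\Lambda\delta_0^T=\delta_0^T$, i.e. $\Lambda(0,0)=1$ and $\Lambda(i,0)=0$ for $i\ge1$. Therefore the law of $T_0=\min\{t\ge0:X_t=0\}$ when $X_0\sim\pi$ equals the law of $\widehat T_0=\min\{t\ge0:\widehat X_t=0\}$, where $\widehat X$ is the Markov chain with transition matrix $\widehat P$ and initial distribution $\hat\pi_0$.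
   Context: All vectors are row vectors, and $\delta_j$ is the vector with $1$ in position $j$ and $0$ elsewhere. $P_{\mathrm{abs}}$ is $P$ with row $0$ replaced by $\delta_0$ (state $0$ made absorbing). A quasi-link is a not necessarily stochastic (not necessarily nonnegative) matrix with rows summing to $1$. Write $\pi=(\pi(0)\,|\,\pi_{-0})$ with $\pi_{-0}\in\mathbb R^n$, and $P^{i-1}(0,:)=(P^{i-1}(0,0)\,|\,P^{i-1}(0,:)_{-0})\in\mathbb R^{n+1}$ for the row of $P^{i-1}$ indexed by state $0$ (here $|$ denotes concatenation). For $i=1,2,3,\ldots$ define $$\mu_i:=\left(0\,\left|\,\frac{P^{i-1}(0,0)\,\pi_{-0}-\pi(0)\,P^{i-1}(0,:)_{-0}}{P^{i-1}(0,0)-\pi(0)}\right.\right)\in\mathbb R^{n+1},\qquad q_i:=\frac{P^{i-1}(0,0)-P^{i}(0,0)}{P^{i-1}(0,0)-\pi(0)}\in[0,1).$$ $\widehat P$ is the transition kernel on $\{0,1,2,\ldots\}$ with $\widehat P(0,0)=1$ and, for $i>0$, $\widehat P(i,0)=\pi(0)q_i$, $\widehat P(i,1)=[1-\pi(0)]q_i$, $\widehat P(i,i+1)=1-q_i$, all other entries being $0$. The initial distribution is $\hat\pi_0:=\pi(0)\delta_0+[1-\pi(0)]\delta_1$ on $\{0,1,2,\ldots\}$. $\Lambda$ is the matrix with rows indexed by $\{0,1,2,\ldots\}$ and columns by $\{0,\ldots,n\}$ given by $\Lambda(0,:)=\delta_0$ and $\Lambda(i,:)=\mu_i$ for $i>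0$.
   Formalization: The formal theorem additionally assumes P^t(0,0) ≠ π(0) for every t ≥ 0, without which some μ_i and q_i are 0/0 (for example when all rows of P equal π); q_i ∈ [0,1) is then proved. *)

theory Defs
  imports "HOL-Probability.Probability" "Jordan_Normal_Form.Matrix"
begin

unbundle no vec_syntax

text \<open>Kernels and initial laws on \<open>{0..n}\<close> are a \<open>real mat\<close> and a \<open>real vec\<close> of dimension
  \<open>n + 1\<close>; those on the infinite state space \<open>{0, 1, 2, \<dots>}\<close> are functions on \<open>nat\<close>. A matrix with
  infinitely many rows and \<open>n + 1\<close> columns is the sequence of its rows, of type \<open>nat \<Rightarrow> real vec\<close>.\<close>

text \<open>The row-vector product \<open>v A\<close>.\<close>

definition row_mult :: "real vec \<Rightarrow> real mat \<Rightarrow> real vec" where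
  "row_mult v A = A\<^sup>T *\<^sub>v v"

definition stochastic_matrix :: "nat \<Rightarrow> real mat \<Rightarrow> bool" where
  "stochastic_matrix n P \<longleftrightarrow> P \<in> carrier_mat (Suc n) (Suc n) \<and>
     (\<forall>i\<le>n. \<forall>j\<le>n. 0 \<le> P $$ (i, j)) \<and> (\<forall>i\<le>n. (\<Sum>j\<le>n. P $$ (i, j)) = 1)"

definition irreducible_matrix :: "nat \<Rightarrow> real mat \<Rightarrow> bool" where
  "irreducible_matrix n P \<longleftrightarrow> (\<forall>i\<le>n. \<forall>j\<le>n. \<exists>t. 0 < (P ^\<^sub>m t) $$ (i, j))"

definition aperiodic_matrix :: "nat \<Rightarrow> real mat \<Rightarrow> bool" where
  "aperiodic_matrix n P \<longleftrightarrow> (\<forall>i\<le>n. Gcd {t. 1 \<le> t \<and> 0 < (P ^\<^sub>m t) $$ (i, i)} = (1::nat))"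

definition ergodic_matrix :: "nat \<Rightarrow> real mat \<Rightarrow> bool" where
  "ergodic_matrix n P \<longleftrightarrow>
     stochastic_matrix n P \<and> irreducible_matrix n P \<and> aperiodic_matrix n P"

definition stationary_distribution :: "nat \<Rightarrow> real mat \<Rightarrow> real vec \<Rightarrow> bool" where
  "stationary_distribution n P \<pi> \<longleftrightarrow> \<pi> \<in> carrier_vec (Suc n) \<and>
     (\<forall>i\<le>n. 0 \<le> \<pi> $ i) \<and> (\<Sum>i\<le>n. \<pi> $ i) = 1 \<and> row_mult \<pi> P = \<pi>"

definition P_abs :: "nat \<Rightarrow> real mat \<Rightarrow> real mat" where
  "P_abs n P = mat (Suc n) (Suc n)
     (\<lambda>(i, j). if i = 0 then unit_vec (Suc n) 0 $ j else P $$ (i, j))"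

text \<open>The quantities \<open>\<mu>\<^sub>i\<close> and \<open>q\<^sub>i\<close> are meant for \<open>i \<ge> 1\<close> and \<open>P\<^bsup>i-1\<^esup>(0,0) \<noteq> \<pi>(0)\<close>.\<close>

definition mu :: "nat \<Rightarrow> real mat \<Rightarrow> real vec \<Rightarrow> nat \<Rightarrow> real vec" where
  "mu n P \<pi> i = vec (Suc n) (\<lambda>j. if j = 0 then 0 else
     ((P ^\<^sub>m (i - 1)) $$ (0, 0) * \<pi> $ j - \<pi> $ 0 * (P ^\<^sub>m (i - 1)) $$ (0, j))
       / ((P ^\<^sub>m (i - 1)) $$ (0, 0) - \<pi> $ 0))"

definition q :: "real mat \<Rightarrow> real vec \<Rightarrow> nat \<Rightarrow> real" where
  "q P \<pi> i = ((P ^\<^sub>m (i - 1)) $$ (0, 0) - (P ^\<^sub>m i) $$ (0, 0))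
     / ((P ^\<^sub>m (i - 1)) $$ (0, 0) - \<pi> $ 0)"

definition P_hat :: "real mat \<Rightarrow> real vec \<Rightarrow> nat \<Rightarrow> nat \<Rightarrow> real" where
  "P_hat P \<pi> i j =
     (if i = 0 then (if j = 0 then 1 else 0)
      else if j = 0 then \<pi> $ 0 * q P \<pi> i
      else if j = 1 then (1 - \<pi> $ 0) * q P \<pi> i
      else if j = i + 1 then 1 - q P \<pi> i
      else 0)"

definition pi_hat :: "real vec \<Rightarrow> nat \<Rightarrow> real" where
  "pi_hat \<pi> i = (if i = 0 then \<pi> $ 0 else if i = 1 then 1 - \<pi> $ 0 else 0)"

definition Link :: "nat \<Rightarrow> real mat \<Rightarrow> real vec \<Rightarrow> nat \<Rightarrow> real vec" where
  "Link n P \<pi> i = (if i = 0 then unit_vec (Suc n) 0 else mu n P \<pi> i)"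

definition quasi_link :: "nat \<Rightarrow> (nat \<Rightarrow> real vec) \<Rightarrow> bool" where
  "quasi_link n \<Lambda> \<longleftrightarrow> (\<forall>i. \<Lambda> i \<in> carrier_vec (Suc n) \<and> (\<Sum>j\<le>n. \<Lambda> i $ j) = 1)"

text \<open>\<open>\<Lambda> A = B \<Lambda>\<close> and \<open>\<alpha> = \<beta> \<Lambda>\<close>. The products on the side of \<open>B\<close> and \<open>\<beta>\<close> are infinite series,
  whose convergence is part of the definition.\<close>

definition quasi_intertwining ::
  "nat \<Rightarrow> (nat \<Rightarrow> real vec) \<Rightarrow> real vec \<Rightarrow> real mat \<Rightarrow> (nat \<Rightarrow> real) \<Rightarrow> (nat \<Rightarrow> nat \<Rightarrow> real) \<Rightarrow> bool" where
  "quasi_intertwining n \<Lambda> \<alpha> A \<beta> B \<longleftrightarrow> quasi_link n \<Lambda> \<and>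
     (\<forall>i. \<forall>j\<le>n. (\<lambda>k. B i k * \<Lambda> k $ j) sums (row_mult (\<Lambda> i) A $ j)) \<and>
     (\<forall>j\<le>n. (\<lambda>k. \<beta> k * \<Lambda> k $ j) sums (\<alpha> $ j))"

text \<open>The Markov chain on the state space \<open>S\<close> with initial law \<open>\<nu>\<close> and kernel \<open>K\<close>. The Markov
  property is only required on histories of positive probability.\<close>

definition markov_chain ::
  "'w measure \<Rightarrow> 's set \<Rightarrow> ('s \<Rightarrow> real) \<Rightarrow> ('s \<Rightarrow> 's \<Rightarrow> real) \<Rightarrow> (nat \<Rightarrow> 'w \<Rightarrow> 's) \<Rightarrow> bool" where
  "markov_chain M S \<nu> K X \<longleftrightarrow> prob_space M \<and>
     (\<forall>t. X t \<in> measurable M (count_space S)) \<and>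
     (\<forall>x\<in>S. \<P>(\<omega> in M. X 0 \<omega> = x) = \<nu> x) \<and>
     (\<forall>t x. \<forall>y\<in>S. (\<forall>s\<le>t. x s \<in> S) \<longrightarrow> \<P>(\<omega> in M. \<forall>s\<le>t. X s \<omega> = x s) > 0 \<longrightarrow>
        \<P>(\<omega> in M. X (Suc t) \<omega> = y \<bar> \<forall>s\<le>t. X s \<omega> = x s) = K (x t) y)"

text \<open>The first time in state \<open>0\<close>, which is \<open>\<infinity>\<close> if \<open>0\<close> is never visited (the infimum of the
  empty set).\<close>

definition hitting_time :: "(nat \<Rightarrow> 'w \<Rightarrow> nat) \<Rightarrow> 'w \<Rightarrow> enat" where
  "hitting_time X \<omega> = Inf {enat t | t. X t \<omega> = 0}"

end

theory Submission
  imports Defs "HOL-Complex_Analysis.Great_Picard"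
begin

unbundle no vec_syntax

text \<open>The intertwining relation is a computation with \<open>\<mu>\<^sub>i = (a \<pi> - \<pi>(0) P\<^bsup>i-1\<^esup>(0,\<sqdot>)) / (a - \<pi>(0))\<close>,
  where \<open>a = P\<^bsup>i-1\<^esup>(0,0)\<close>: the entry of \<open>\<mu>\<^sub>i\<close> at \<open>0\<close> vanishes, so \<open>\<mu>\<^sub>i P\<^sub>a\<^sub>b\<^sub>s = \<mu>\<^sub>i P\<close>. For the laws,
  the subprobability vectors \<open>w\<^sub>t(y)\<close> of being in \<open>y\<close> at time \<open>t\<close> without having met \<open>0\<close> before satisfy
  \<open>w\<^sub>t = w'\<^sub>t \<Lambda>\<close> by induction on \<open>t\<close>, where \<open>w'\<^sub>t\<close> belongs to the other chain, and comparing
  entries at \<open>0\<close> gives the law of the hitting time. Signs play no role there,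
  and all sums over the infinite state space are finite because the chain with kernel \<open>P_hat\<close> climbs by at most one level per step.\<close>

section \<open>Entrywise matrix products, powers and stationarity\<close>

lemma mult_mat_entry:
  assumes "A \<in> carrier_mat (Suc n) (Suc n)" "B \<in> carrier_mat (Suc n) (Suc n)" "i \<le> n" "j \<le> n"
  shows "(A * B) $$ (i, j) = (\<Sum>k\<le>n. A $$ (i, k) * B $$ (k, j))"
proof -
  have "{0..<Suc n} = {..n}" by auto
  with assms show ?thesis by (auto simp: scalar_prod_def)
qed

lemma row_mult_entry:
  assumes "A \<in> carrier_mat (Suc n) (Suc n)" "v \<in> carrier_vec (Suc n)" "j \<le> n"
  shows "row_mult v A $ j = (\<Sum>k\<le>n. v $ k * A $$ (k, j))"
proof -
  have "{0..<Suc n} = {..n}" by auto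
  with assms show ?thesis by (auto simp: row_mult_def scalar_prod_def mult.commute)
qed

lemma stochastic_matrix_pow:
  assumes "stochastic_matrix n P"
  shows "stochastic_matrix n (P ^\<^sub>m t)"
proof (induction t)
  case 0
  have "P \<in> carrier_mat (Suc n) (Suc n)" using assms by (simp add: stochastic_matrix_def)
  then show ?case by (auto simp: stochastic_matrix_def one_mat_def)
next
  case (Suc t)
  let ?A = "P ^\<^sub>m t"
  have c: "P \<in> carrier_mat (Suc n) (Suc n)" "?A \<in> carrier_mat (Suc n) (Suc n)"
    using assms Suc by (simp_all add: stochastic_matrix_def)
  have e: "(P ^\<^sub>m Suc t) $$ (i, j) = (\<Sum>k\<le>n. ?A $$ (i, k) * P $$ (k, j))" if "i \<le> n" "j \<le> n" for i j
    using mult_mat_entry[OF c(2,1) that] by simp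
  have "(\<Sum>j\<le>n. (P ^\<^sub>m Suc t) $$ (i, j)) = 1" if "i \<le> n" for i
  proof -
    have "(\<Sum>j\<le>n. (P ^\<^sub>m Suc t) $$ (i, j)) = (\<Sum>j\<le>n. \<Sum>k\<le>n. ?A $$ (i, k) * P $$ (k, j))"
      using that by (intro sum.cong refl e) simp_all
    also have "\<dots> = (\<Sum>k\<le>n. ?A $$ (i, k) * (\<Sum>j\<le>n. P $$ (k, j)))"
      by (subst sum.swap) (simp add: sum_distrib_left)
    also have "\<dots> = 1" using assms Suc that by (simp add: stochastic_matrix_def)
    finally show ?thesis .
  qed
  moreover have "0 \<le> (P ^\<^sub>m Suc t) $$ (i, j)" if "i \<le> n" "j \<le> n" for i j
    using assms Suc that unfolding e[OF that] by (intro sum_nonneg) (simp add: stochastic_matrix_def)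
  ultimately show ?case using c by (auto simp: stochastic_matrix_def)
qed

lemma pow_mat_Suc_entry:
  assumes "P \<in> carrier_mat (Suc n) (Suc n)" "i \<le> n" "j \<le> n"
  shows "(P ^\<^sub>m Suc t) $$ (i, j) = (\<Sum>k\<le>n. (P ^\<^sub>m t) $$ (i, k) * P $$ (k, j))"
  using mult_mat_entry[OF _ assms(1-3), of "P ^\<^sub>m t"] assms(1) by simp

text \<open>\<open>pow_mat\<close> unfolds with the new factor on the right. Applying P to the
  columns P^t(.,0) needs it on the left.\<close>

lemma pow_mat_Suc_left:
  assumes "P \<in> carrier_mat m m"
  shows "P ^\<^sub>m Suc t = P * P ^\<^sub>m t"
proof (induction t)
  case 0
  then show ?case using assms by simp
next
  case (Suc t)
  have "P ^\<^sub>m Suc (Suc t) = (P * P ^\<^sub>m t) * P" using Suc by simp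
  also have "\<dots> = P * (P ^\<^sub>m t * P)" using assms by (intro assoc_mult_mat) auto
  finally show ?case by simp
qed

lemma pow_mat_Suc_entry_left:
  assumes "P \<in> carrier_mat (Suc n) (Suc n)" "i \<le> n" "j \<le> n"
  shows "(P ^\<^sub>m Suc t) $$ (i, j) = (\<Sum>k\<le>n. P $$ (i, k) * (P ^\<^sub>m t) $$ (k, j))"
  unfolding pow_mat_Suc_left[OF assms(1)] using assms by (intro mult_mat_entry) auto

lemma stationary_pow:
  assumes "P \<in> carrier_mat (Suc n) (Suc n)" "stationary_distribution n P \<pi>" "j \<le> n"
  shows "(\<Sum>i\<le>n. \<pi> $ i * (P ^\<^sub>m t) $$ (i, j)) = \<pi> $ j"
  using assms(3)
proof (induction t arbitrary: j)
  case 0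
  then have "(\<Sum>i\<le>n. \<pi> $ i * (P ^\<^sub>m 0) $$ (i, j)) = (\<Sum>i\<le>n. if i = j then \<pi> $ i else 0)"
    using assms(1) by (intro sum.cong) auto
  then show ?case using 0 by simp
next
  case (Suc t)
  have "(\<Sum>i\<le>n. \<pi> $ i * (P ^\<^sub>m Suc t) $$ (i, j))
      = (\<Sum>i\<le>n. \<Sum>k\<le>n. \<pi> $ i * (P ^\<^sub>m t) $$ (i, k) * P $$ (k, j))"
    using Suc.prems by (intro sum.cong)
      (simp_all add: pow_mat_Suc_entry[OF assms(1)] sum_distrib_left mult.assoc del: pow_mat.simps)
  also have "\<dots> = (\<Sum>k\<le>n. (\<Sum>i\<le>n. \<pi> $ i * (P ^\<^sub>m t) $$ (i, k)) * P $$ (k, j))"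
    by (subst sum.swap) (simp add: sum_distrib_right)
  also have "\<dots> = (\<Sum>k\<le>n. \<pi> $ k * P $$ (k, j))"
    by (intro sum.cong) (simp_all add: Suc.IH)
  also have "\<dots> = row_mult \<pi> P $ j"
    using assms Suc.prems by (intro row_mult_entry[symmetric]) (simp_all add: stationary_distribution_def)
  also have "\<dots> = \<pi> $ j" using assms(2) by (simp add: stationary_distribution_def)
  finally show ?case .
qed

section \<open>Harmonic functions and the lower bound for return probabilities\<close>

text \<open>Maximum principle: g is harmonic for every power of P as well. At a maximiser m, the
  nonnegative terms P^t(m,j) (g m - g j) add up to 0, so each vanishes. For each k, irreducibility
  supplies a t with P^t(m,k) > 0, whence g k = g m.\<close>

lemma harmonic_constant:
  assumes "stochastic_matrix n P" "irreducible_matrix n P"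
    and harmonic: "\<And>i. i \<le> n \<Longrightarrow> (\<Sum>j\<le>n. P $$ (i, j) * g j) = g i"
    and "i \<le> n" "j \<le> n"
  shows "g i = (g j :: real)"
proof -
  have P: "P \<in> carrier_mat (Suc n) (Suc n)" using assms by (simp add: stochastic_matrix_def)
  have harmonic_pow: "(\<Sum>j\<le>n. (P ^\<^sub>m t) $$ (i, j) * g j) = g i" if "i \<le> n" for t i
    using that
  proof (induction t)
    case 0
    then have "(\<Sum>j\<le>n. (P ^\<^sub>m 0) $$ (i, j) * g j) = (\<Sum>j\<le>n. if j = i then g j else 0)"
      using P by (intro sum.cong) auto
    then show ?case using 0 by simp
  next
    case (Suc t)
    have "(\<Sum>j\<le>n. (P ^\<^sub>m Suc t) $$ (i, j) * g j)
        = (\<Sum>j\<le>n. \<Sum>k\<le>n. (P ^\<^sub>m t) $$ (i, k) * (P $$ (k, j) * g j))"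
      using Suc.prems by (intro sum.cong)
        (simp_all add: pow_mat_Suc_entry[OF P] sum_distrib_right mult.assoc del: pow_mat.simps)
    also have "\<dots> = (\<Sum>k\<le>n. (P ^\<^sub>m t) $$ (i, k) * g k)"
      by (subst sum.swap) (simp add: sum_distrib_left[symmetric] harmonic)
    finally show ?case using Suc by simp
  qed
  obtain m where m: "m \<le> n" "\<And>k. k \<le> n \<Longrightarrow> g k \<le> g m"
  proof -
    have "Max (g ` {..n}) \<in> g ` {..n}" by (intro Max_in) auto
    then obtain m where "m \<le> n" "g m = Max (g ` {..n})" unfolding image_iff by force
    then show ?thesis using that by (metis Max_ge atMost_iff finite_atMost finite_imageI imageI)
  qed
  have "g k = g m" if k: "k \<le> n" for k
  proof -
    obtain t where t: "0 < (P ^\<^sub>m t) $$ (m, k)"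
      using assms(2) m(1) k by (auto simp: irreducible_matrix_def)
    have st: "stochastic_matrix n (P ^\<^sub>m t)" using assms(1) by (rule stochastic_matrix_pow)
    have "(\<Sum>j\<le>n. (P ^\<^sub>m t) $$ (m, j) * (g m - g j)) = 0"
      using st m(1) harmonic_pow[OF m(1)]
      by (simp add: right_diff_distrib sum_subtractf sum_distrib_right[symmetric] stochastic_matrix_def)
    moreover have "0 \<le> (P ^\<^sub>m t) $$ (m, j) * (g m - g j)" if "j \<le> n" for j
      using st m that by (simp add: stochastic_matrix_def)
    ultimately have "(P ^\<^sub>m t) $$ (m, k) * (g m - g k) = 0"
      using k by (subst (asm) sum_nonneg_eq_0_iff) auto
    then show ?thesis using t by simp
  qed
  with assms(4,5) show ?thesis by metis
qed

text \<open>A subsequential limit of the averages of \<open>P\<^bsup>t\<^esup>(\<sqdot>,0)\<close> over windows starting at \<open>t\<^sub>0\<close> is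
  harmonic, hence constantly \<open>\<pi>(0)\<close>, while monotonicity bounds its entry at \<open>0\<close> by \<open>P\<^bsup>t\<^sub>0\<^esup>(0,0)\<close>.\<close>

lemma stationary_le_return_prob:
  assumes st: "stochastic_matrix n P" and irr: "irreducible_matrix n P"
    and stat: "stationary_distribution n P \<pi>"
    and dec: "decseq (\<lambda>t. (P ^\<^sub>m t) $$ (0, 0))"
  shows "\<pi> $ 0 \<le> (P ^\<^sub>m t0) $$ (0, 0)"
proof -
  have P: "P \<in> carrier_mat (Suc n) (Suc n)" using st by (simp add: stochastic_matrix_def)
  \<comment> \<open>The window has T + 1 terms, so the denominator is never 0. All averages lie in
    [0,1], which gives the compactness used below.\<close>
  define g where "g T i = (\<Sum>s<Suc T. (P ^\<^sub>m (t0 + s)) $$ (i, 0)) / real (Suc T)" for T i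
  have nonneg: "0 \<le> (P ^\<^sub>m t) $$ (i, 0)" if "i \<le> n" for t i
    using stochastic_matrix_pow[OF st, of t] that by (simp add: stochastic_matrix_def)
  have le1: "(P ^\<^sub>m t) $$ (i, 0) \<le> 1" if "i \<le> n" for t i
  proof -
    have "(P ^\<^sub>m t) $$ (i, 0) \<le> (\<Sum>j\<le>n. (P ^\<^sub>m t) $$ (i, j))"
      using stochastic_matrix_pow[OF st, of t] that
      by (intro member_le_sum) (auto simp: stochastic_matrix_def)
    then show ?thesis using stochastic_matrix_pow[OF st, of t] that by (simp add: stochastic_matrix_def)
  qed
  have "norm (g T i) \<le> 1" if "i \<in> {..n}" for T i
  proof -
    have "(\<Sum>s<Suc T. (P ^\<^sub>m (t0 + s)) $$ (i, 0)) \<le> (\<Sum>s<Suc T. 1)"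
      using that by (intro sum_mono le1) simp
    moreover have "0 \<le> (\<Sum>s<Suc T. (P ^\<^sub>m (t0 + s)) $$ (i, 0))"
      using that by (intro sum_nonneg nonneg) simp
    ultimately show ?thesis by (simp add: g_def field_simps)
  qed
  \<comment> \<open>A diagonal extraction: one subsequence \<open>r\<close> serves all states at
    once.\<close>
  with countable_finite[OF finite_atMost] obtain r where r: "strict_mono (r :: nat \<Rightarrow> nat)"
    "\<And>i. i \<in> {..n} \<Longrightarrow> \<exists>l. (\<lambda>k. g (r k) i) \<longlonglongrightarrow> l"
    by (rule function_convergent_subsequence[of "{..n}" g 1]) blast+
  then obtain h where h: "\<And>i. i \<le> n \<Longrightarrow> (\<lambda>k. g (r k) i) \<longlonglongrightarrow> h i"
    by (metis atMost_iff)
  \<comment> \<open>Applying P shifts the window by one, so only its two end terms survive. They lie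
    in [0,1], hence the defect from harmonicity is at most 1/(T + 1).\<close>
  have step: "(\<Sum>j\<le>n. P $$ (i, j) * g T j) - g T i
      = ((P ^\<^sub>m (t0 + Suc T)) $$ (i, 0) - (P ^\<^sub>m t0) $$ (i, 0)) / real (Suc T)" if "i \<le> n" for T i
  proof -
    have "(\<Sum>j\<le>n. P $$ (i, j) * g T j)
        = (\<Sum>j\<le>n. \<Sum>s<Suc T. P $$ (i, j) * (P ^\<^sub>m (t0 + s)) $$ (j, 0)) / real (Suc T)"
      unfolding g_def by (simp add: sum_divide_distrib sum_distrib_left del: sum.lessThan_Suc)
    also have "(\<Sum>j\<le>n. \<Sum>s<Suc T. P $$ (i, j) * (P ^\<^sub>m (t0 + s)) $$ (j, 0))
        = (\<Sum>s<Suc T. (P ^\<^sub>m Suc (t0 + s)) $$ (i, 0))"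
      using that by (subst sum.swap)
        (simp add: pow_mat_Suc_entry_left[OF P] del: pow_mat.simps sum.lessThan_Suc)
    finally have "(\<Sum>j\<le>n. P $$ (i, j) * g T j) - g T i
      = (\<Sum>s<Suc T. (P ^\<^sub>m (t0 + Suc s)) $$ (i, 0) - (P ^\<^sub>m (t0 + s)) $$ (i, 0)) / real (Suc T)"
      by (simp add: g_def sum_subtractf diff_divide_distrib del: pow_mat.simps sum.lessThan_Suc)
    then show ?thesis using sum_lessThan_telescope[of "\<lambda>s. (P ^\<^sub>m (t0 + s)) $$ (i, 0)" "Suc T"] by simp
  qed
  have "(\<Sum>j\<le>n. P $$ (i, j) * h j) = h i" if i: "i \<le> n" for i
  proof -
    have "(\<lambda>k. (\<Sum>j\<le>n. P $$ (i, j) * g (r k) j) - g (r k) i) \<longlonglongrightarrow> (\<Sum>j\<le>n. P $$ (i, j) * h j) - h i"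
      using i by (intro tendsto_intros h) auto
    moreover have "(\<lambda>k. (\<Sum>j\<le>n. P $$ (i, j) * g (r k) j) - g (r k) i) \<longlonglongrightarrow> 0"
    proof (rule Lim_null_comparison)
      have "\<bar>(P ^\<^sub>m (t0 + Suc T)) $$ (i, 0) - (P ^\<^sub>m t0) $$ (i, 0)\<bar> \<le> 1" for T
        using nonneg[OF i, of "t0 + Suc T"] le1[OF i, of "t0 + Suc T"] nonneg[OF i, of t0] le1[OF i, of t0]
        by linarith
      then show "\<forall>\<^sub>F k in sequentially.
          norm ((\<Sum>j\<le>n. P $$ (i, j) * g (r k) j) - g (r k) i) \<le> inverse (real (Suc (r k)))"
        unfolding step[OF i] by (intro always_eventually) (auto simp: divide_simps simp del: pow_mat.simps)
      show "(\<lambda>k. inverse (real (Suc (r k)))) \<longlonglongrightarrow> 0"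
        using LIMSEQ_subseq_LIMSEQ[OF LIMSEQ_inverse_real_of_nat r(1)] by (simp add: o_def)
    qed
    ultimately show ?thesis using LIMSEQ_unique by fastforce
  qed
  then have const: "h i = h 0" if "i \<le> n" for i
    using harmonic_constant[OF st irr, of h i 0] that by simp
  \<comment> \<open>Stationarity fixes the \<pi>-average of each window, and so that of the limit.
    As h is constant, its value must be \<pi>(0).\<close>
  have "(\<Sum>i\<le>n. \<pi> $ i * g T i) = \<pi> $ 0" for T
  proof -
    have "(\<Sum>i\<le>n. \<pi> $ i * g T i)
        = (\<Sum>i\<le>n. \<Sum>s<Suc T. \<pi> $ i * (P ^\<^sub>m (t0 + s)) $$ (i, 0)) / real (Suc T)"
      unfolding g_def by (simp add: sum_divide_distrib sum_distrib_left del: sum.lessThan_Suc)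
    also have "(\<Sum>i\<le>n. \<Sum>s<Suc T. \<pi> $ i * (P ^\<^sub>m (t0 + s)) $$ (i, 0)) = real (Suc T) * \<pi> $ 0"
      by (subst sum.swap) (simp add: stationary_pow[OF P stat] del: sum.lessThan_Suc)
    finally show ?thesis by simp
  qed
  moreover have "(\<lambda>k. \<Sum>i\<le>n. \<pi> $ i * g (r k) i) \<longlonglongrightarrow> (\<Sum>i\<le>n. \<pi> $ i * h i)"
    by (intro tendsto_intros h) auto
  ultimately have "\<pi> $ 0 = (\<Sum>i\<le>n. \<pi> $ i * h i)"
    by (simp add: LIMSEQ_const_iff)
  also have "\<dots> = (\<Sum>i\<le>n. \<pi> $ i * h 0)"
    by (intro sum.cong refl) (metis atMost_iff const)
  also have "\<dots> = h 0"
    using stat by (simp add: sum_distrib_right[symmetric] stationary_distribution_def)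
  finally have "\<pi> $ 0 = h 0" .
  \<comment> \<open>Monotonicity enters here: the term at t0 is the largest of its window.\<close>
  moreover have "g T 0 \<le> (P ^\<^sub>m t0) $$ (0, 0)" for T
  proof -
    have "(\<Sum>s<Suc T. (P ^\<^sub>m (t0 + s)) $$ (0, 0)) \<le> (\<Sum>s<Suc T. (P ^\<^sub>m t0) $$ (0, 0))"
      by (intro sum_mono decseqD[OF dec]) simp
    then show ?thesis by (simp add: g_def field_simps)
  qed
  then have "h 0 \<le> (P ^\<^sub>m t0) $$ (0, 0)"
    using h[of 0] by (intro LIMSEQ_le_const2) auto
  ultimately show ?thesis by simp
qed

section \<open>One-step recursion for paths that avoid 0\<close>

text \<open>Avoidance is required strictly before t only. Thus the entry at y = 0 is the probability
  that the hitting time equals t, and the other entries are the mass still alive. Keeping both in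
  one vector lets the link act on it.\<close>

definition first_visit_prob :: "'w measure \<Rightarrow> (nat \<Rightarrow> 'w \<Rightarrow> nat) \<Rightarrow> nat \<Rightarrow> nat \<Rightarrow> real" where
  "first_visit_prob M X t y = \<P>(\<omega> in M. (\<forall>s<t. X s \<omega> \<noteq> 0) \<and> X t \<omega> = y)"

text \<open>\<open>markov_chain\<close> conditions on complete histories, whereas a single state is
  wanted here. The event is split into the countably many histories that end in x and avoid 0
  before. Each contributes the same factor K x y; a null history contributes 0 to both
  sides.\<close>

lemma markov_chain_prob_step:
  fixes X :: "nat \<Rightarrow> 'w \<Rightarrow> nat"
  assumes mc: "markov_chain M S \<nu> K X" and y: "y \<in> S"
    and K: "\<And>x. x \<in> S \<Longrightarrow> 0 \<le> K x y" and x: "x \<in> S"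
  shows "\<P>(\<omega> in M. ((\<forall>s<t. X s \<omega> \<noteq> 0) \<and> X t \<omega> = x) \<and> X (Suc t) \<omega> = y)
    = first_visit_prob M X t x * K x y"
proof -
  interpret prob_space M using mc by (simp add: markov_chain_def)
  have X: "X s \<in> measurable M (count_space S)" for s using mc by (simp add: markov_chain_def)
  have XS: "X s \<omega> \<in> S" if "\<omega> \<in> space M" for s \<omega>
    using measurable_space[OF X that] by simp
  have X': "X s \<in> measurable M (count_space UNIV)" for s
    using measurable_compose[OF X[of s], of "\<lambda>x. x" "count_space UNIV"] by simp
  note [measurable] = X'
  \<comment> \<open>Histories are extensional functions on {..t}, so two distinct ones differ at
    some time up to t and give disjoint events.\<close>
  define I where "I = {h \<in> PiE {..t} (\<lambda>_. S). h t = x \<and> (\<forall>s<t. h s \<noteq> (0::nat))}"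
  define H where "H h = {\<omega> \<in> space M. \<forall>s\<le>t. X s \<omega> = h s}" for h
  define Y where "Y = {\<omega> \<in> space M. X (Suc t) \<omega> = y}"
  have "countable (PiE {..t} (\<lambda>_. S))" by (intro countable_PiE) auto
  then have I: "countable I" unfolding I_def by (rule countable_subset[rotated]) auto
  have meas [measurable]: "H h \<in> sets M" "Y \<in> sets M" for h unfolding H_def Y_def by measurable
  have disj: "disjoint_family_on H I"
  proof (clarsimp simp: disjoint_family_on_def)
    fix h h' assume "h \<in> I" "h' \<in> I" "h \<noteq> h'"
    then obtain s where "s \<le> t" "h s \<noteq> h' s"
      unfolding I_def by (metis (no_types, lifting) PiE_ext atMost_iff mem_Collect_eq)
    then show "H h \<inter> H h' = {}" by (auto simp: H_def)
  qed
  have un: "{\<omega> \<in> space M. (\<forall>s<t. X s \<omega> \<noteq> 0) \<and> X t \<omega> = x} = (\<Union>h\<in>I. H h)"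
  proof (intro equalityI subsetI)
    fix \<omega> assume w: "\<omega> \<in> {\<omega> \<in> space M. (\<forall>s<t. X s \<omega> \<noteq> 0) \<and> X t \<omega> = x}"
    then have "restrict (\<lambda>s. X s \<omega>) {..t} \<in> I" using XS by (auto simp: I_def)
    moreover have "\<omega> \<in> H (restrict (\<lambda>s. X s \<omega>) {..t})" using w by (auto simp: H_def)
    ultimately show "\<omega> \<in> (\<Union>h\<in>I. H h)" by blast
  qed (auto simp: I_def H_def)
  \<comment> \<open>With \<open>emeasure\<close>, summing over the possibly infinite
    \<open>I\<close> raises no convergence question. Nonnegativity of K lets the factor pass through
    \<open>ennreal\<close>.\<close>
  have step: "emeasure M (H h \<inter> Y) = ennreal (K x y) * emeasure M (H h)" if h: "h \<in> I" for h
  proof (cases "measure M (H h) > 0")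
    case True
    have "\<forall>s\<le>t. h s \<in> S" "h t = x" using h by (auto simp: I_def)
    moreover have "(\<forall>s\<le>t. h s \<in> S) \<longrightarrow> \<P>(\<omega> in M. \<forall>s\<le>t. X s \<omega> = h s) > 0 \<longrightarrow>
        \<P>(\<omega> in M. X (Suc t) \<omega> = y \<bar> \<forall>s\<le>t. X s \<omega> = h s) = K (h t) y"
      using mc y unfolding markov_chain_def by blast
    ultimately have "\<P>(\<omega> in M. X (Suc t) \<omega> = y \<bar> \<forall>s\<le>t. X s \<omega> = h s) = K x y"
      using True by (simp add: H_def)
    moreover have "{\<omega> \<in> space M. X (Suc t) \<omega> = y \<and> (\<forall>s\<le>t. X s \<omega> = h s)} = H h \<inter> Y"
      by (auto simp: H_def Y_def)
    ultimately have "measure M (H h \<inter> Y) = K x y * measure M (H h)"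
      using True by (simp add: cond_prob_def H_def field_simps)
    then show ?thesis using K[OF x] by (simp add: emeasure_eq_measure ennreal_mult)
  next
    case False
    then have "emeasure M (H h) = 0"
      by (simp add: emeasure_eq_measure not_less measure_le_0_iff)
    moreover from this have "emeasure M (H h \<inter> Y) = 0"
      using emeasure_mono[of "H h \<inter> Y" "H h" M] meas by simp
    ultimately show ?thesis by simp
  qed
  have "{\<omega> \<in> space M. ((\<forall>s<t. X s \<omega> \<noteq> 0) \<and> X t \<omega> = x) \<and> X (Suc t) \<omega> = y} = (\<Union>h\<in>I. H h \<inter> Y)"
    using un by (auto simp: Y_def)
  then have "emeasure M {\<omega> \<in> space M. ((\<forall>s<t. X s \<omega> \<noteq> 0) \<and> X t \<omega> = x) \<and> X (Suc t) \<omega> = y}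
      = (\<integral>\<^sup>+h. emeasure M (H h \<inter> Y) \<partial>count_space I)"
    using disj I by (simp only:, intro emeasure_UN_countable)
      (use meas in \<open>simp_all add: disjoint_family_on_def, blast\<close>)
  also have "\<dots> = (\<integral>\<^sup>+h. ennreal (K x y) * emeasure M (H h) \<partial>count_space I)"
    by (intro nn_integral_cong) (simp add: step)
  also have "\<dots> = ennreal (K x y) * (\<integral>\<^sup>+h. emeasure M (H h) \<partial>count_space I)"
    by (intro nn_integral_cmult) simp
  also have "(\<integral>\<^sup>+h. emeasure M (H h) \<partial>count_space I) = emeasure M (\<Union>h\<in>I. H h)"
    using disj I by (intro emeasure_UN_countable[symmetric]) auto
  also have "(\<Union>h\<in>I. H h) = {\<omega> \<in> space M. (\<forall>s<t. X s \<omega> \<noteq> 0) \<and> X t \<omega> = x}"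
    using un by simp
  finally show ?thesis
    using K[OF x] by (simp add: first_visit_prob_def emeasure_eq_measure ennreal_mult[symmetric] mult.commute)
qed

lemma first_visit_prob_outside:
  fixes X :: "nat \<Rightarrow> 'w \<Rightarrow> nat"
  assumes "markov_chain M S \<nu> K X" "y \<notin> S"
  shows "first_visit_prob M X t y = 0"
proof -
  have "X t \<in> measurable M (count_space S)" using assms(1) by (simp add: markov_chain_def)
  then have "X t \<omega> \<in> S" if "\<omega> \<in> space M" for \<omega>
    using measurable_space[of "X t" M "count_space S" \<omega>] that by simp
  with assms(2) have e: "{\<omega> \<in> space M. (\<forall>s<t. X s \<omega> \<noteq> 0) \<and> X t \<omega> = y} = {}" by auto
  show ?thesis unfolding first_visit_prob_def e by simp
qed

lemma first_visit_prob_0: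
  fixes X :: "nat \<Rightarrow> 'w \<Rightarrow> nat"
  assumes "markov_chain M S \<nu> K X" "y \<in> S"
  shows "first_visit_prob M X 0 y = \<nu> y"
  using assms by (simp add: first_visit_prob_def markov_chain_def)

text \<open>Split by the state at time t. The summand at 0 is set to 0 because a path that is in 0
  at time t no longer counts at time t + 1. States outside S carry no mass, so the series may run
  over all naturals.\<close>

lemma first_visit_prob_Suc:
  fixes X :: "nat \<Rightarrow> 'w \<Rightarrow> nat"
  assumes mc: "markov_chain M S \<nu> K X" and y: "y \<in> S"
    and K: "\<And>x. x \<in> S \<Longrightarrow> 0 \<le> K x y"
  shows "(\<lambda>x. if x = 0 then 0 else first_visit_prob M X t x * K x y) sums first_visit_prob M X (Suc t) y"
proof -
  interpret prob_space M using mc by (simp add: markov_chain_def)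
  have X: "X s \<in> measurable M (count_space S)" for s using mc by (simp add: markov_chain_def)
  have X': "X s \<in> measurable M (count_space UNIV)" for s
    using measurable_compose[OF X[of s], of "\<lambda>x. x" "count_space UNIV"] by simp
  note [measurable] = X'
  define A where "A x = (if x = 0 then {} else
    {\<omega> \<in> space M. ((\<forall>s<t. X s \<omega> \<noteq> 0) \<and> X t \<omega> = x) \<and> X (Suc t) \<omega> = y})" for x
  have meas: "A x \<in> sets M" for x unfolding A_def by (cases "x = 0") simp_all
  have "(\<lambda>x. measure M (A x)) sums measure M (\<Union>x. A x)"
    using meas by (intro finite_measure_UNION) (auto simp: disjoint_family_on_def A_def)
  moreover have "(\<Union>x. A x) = {\<omega> \<in> space M. (\<forall>s<Suc t. X s \<omega> \<noteq> 0) \<and> X (Suc t) \<omega> = y}"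
    by (auto simp: A_def less_Suc_eq split: if_splits)
  moreover have "measure M (A x) = (if x = 0 then 0 else first_visit_prob M X t x * K x y)" for x
  proof (cases "x \<in> S")
    case True
    then show ?thesis using markov_chain_prob_step[OF mc y K True] by (simp add: A_def)
  next
    case False
    have "X t \<omega> \<in> S" if "\<omega> \<in> space M" for \<omega> using measurable_space[OF X that] by simp
    with False have "A x = {}" by (auto simp: A_def)
    then show ?thesis using first_visit_prob_outside[OF mc False] by simp
  qed
  ultimately show ?thesis by (simp add: first_visit_prob_def)
qed

section \<open>The law of the hitting time\<close>

lemma hitting_time_eq_enat:
  "hitting_time X \<omega> = enat t \<longleftrightarrow> (\<forall>s<t. X s \<omega> \<noteq> 0) \<and> X t \<omega> = 0"
proof
  assume "hitting_time X \<omega> = enat t"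
  then have Inf: "Inf {enat t | t. X t \<omega> = 0} = enat t" by (simp add: hitting_time_def)
  \<comment> \<open>An empty set would have infimum \<infinity>. For a nonempty set,
    \<open>Inf\<close> on \<open>enat\<close> is a least element and so is attained.\<close>
  then have "{enat t | t. X t \<omega> = 0} \<noteq> {}" unfolding Inf_enat_def by (auto split: if_splits)
  then have "enat t \<in> {enat t | t. X t \<omega> = 0}"
    unfolding Inf[symmetric] Inf_enat_def by (auto intro: LeastI)
  moreover have "\<not> s < t" if "X s \<omega> = 0" for s
    using that Inf Inf_lower[of "enat s" "{enat t | t. X t \<omega> = 0}"] by fastforce
  ultimately show "(\<forall>s<t. X s \<omega> \<noteq> 0) \<and> X t \<omega> = 0" by auto
next
  assume h: "(\<forall>s<t. X s \<omega> \<noteq> 0) \<and> X t \<omega> = 0"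
  show "hitting_time X \<omega> = enat t" unfolding hitting_time_def
    using h by (intro antisym Inf_lower Inf_greatest) (auto simp: not_less[symmetric])
qed

lemma hitting_time_measurable:
  assumes "\<And>t. X t \<in> measurable M (count_space UNIV)"
  shows "hitting_time X \<in> measurable M (count_space UNIV)"
proof -
  note [measurable] = assms
  have fin: "hitting_time X -` {enat t} \<inter> space M \<in> sets M" for t
  proof -
    have "hitting_time X -` {enat t} \<inter> space M = {\<omega> \<in> space M. (\<forall>s<t. X s \<omega> \<noteq> 0) \<and> X t \<omega> = 0}"
      by (auto simp: hitting_time_eq_enat)
    also have "\<dots> \<in> sets M" by measurable
    finally show ?thesis .
  qed
  have "hitting_time X -` {\<infinity>} \<inter> space M = space M - (\<Union>t. hitting_time X -` {enat t} \<inter> space M)"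
    by auto
  also have "\<dots> \<in> sets M" using fin by blast
  finally have "hitting_time X -` {a} \<inter> space M \<in> sets M" for a
    using fin by (cases a) auto
  then show ?thesis by (subst measurable_count_space_eq2_countable) auto
qed

text \<open>A law on the countable type \<open>enat\<close> is determined by its point masses. Those
  at finite times are first-visit probabilities of 0, and the mass at \<infinity> is what they leave
  of 1.\<close>

lemma distr_hitting_time_eq:
  assumes "prob_space M" "\<And>t. X t \<in> measurable M (count_space UNIV)"
    and "prob_space M'" "\<And>t. X' t \<in> measurable M' (count_space UNIV)"
    and eq: "\<And>t. first_visit_prob M X t 0 = first_visit_prob M' X' t 0"
  shows "distr M (count_space UNIV) (hitting_time X) = distr M' (count_space UNIV) (hitting_time X')"
proof -
  let ?D = "distr M (count_space UNIV) (hitting_time X)"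
  let ?D' = "distr M' (count_space UNIV) (hitting_time X')"
  have m: "hitting_time X \<in> measurable M (count_space UNIV)"
    "hitting_time X' \<in> measurable M' (count_space UNIV)"
    using assms by (simp_all add: hitting_time_measurable)
  interpret D: prob_space ?D using assms(1) m(1) by (rule prob_space.prob_space_distr)
  interpret D': prob_space ?D' using assms(3) m(2) by (rule prob_space.prob_space_distr)
  have fin: "measure ?D {enat t} = measure ?D' {enat t}" for t
  proof -
    have "measure ?D {enat t} = first_visit_prob M X t 0" "measure ?D' {enat t} = first_visit_prob M' X' t 0"
      using m by (auto simp: measure_distr first_visit_prob_def hitting_time_eq_enat intro!: arg_cong[where f="measure _"])
    then show ?thesis using eq by simp
  qed
  have fin_tail: "measure ?D {\<infinity>} = 1 - measure ?D (range enat)" "measure ?D' {\<infinity>} = 1 - measure ?D' (range enat)"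
  proof -
    have "UNIV - range enat = {\<infinity>}" by (auto simp: image_iff)
    then show "measure ?D {\<infinity>} = 1 - measure ?D (range enat)" "measure ?D' {\<infinity>} = 1 - measure ?D' (range enat)"
      using D.prob_compl[of "range enat"] D'.prob_compl[of "range enat"] by simp_all
  qed
  have "(\<lambda>t. measure ?D {enat t}) sums measure ?D (\<Union>t. {enat t})"
    "(\<lambda>t. measure ?D' {enat t}) sums measure ?D' (\<Union>t. {enat t})"
    by (rule D.finite_measure_UNION D'.finite_measure_UNION; auto simp: disjoint_family_on_def)+
  then have "measure ?D (\<Union>t. {enat t}) = measure ?D' (\<Union>t. {enat t})"
    unfolding fin by (rule sums_unique2)
  moreover have "(\<Union>t. {enat t}) = range enat" by auto
  ultimately have "measure ?D {\<infinity>} = measure ?D' {\<infinity>}" using fin_tail by simp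
  with fin have "measure ?D {a} = measure ?D' {a}" for a by (cases a) auto
  then show ?thesis
    by (intro measure_eqI_countable[where A=UNIV]) (auto simp: D.emeasure_eq_measure D'.emeasure_eq_measure)
qed

section \<open>Transfer of first-visit probabilities through a link\<close>

text \<open>The chain starts in {0,1} and climbs by at most one per step, so it is at most t + 1 at
  time t. This makes the sums against link rows finite, so that they can be exchanged although the
  link may have negative entries.\<close>

lemma first_visit_prob_finite_support:
  fixes X :: "nat \<Rightarrow> 'w \<Rightarrow> nat"
  assumes mc: "markov_chain M UNIV \<nu> K X" and K: "\<And>x y. 0 \<le> K x y"
    and \<nu>: "\<And>y. 1 < y \<Longrightarrow> \<nu> y = 0" and jump: "\<And>x y. Suc x < y \<Longrightarrow> K x y = 0"
    and "Suc t < y"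
  shows "first_visit_prob M X t y = 0"
  using \<open>Suc t < y\<close>
proof (induction t arbitrary: y)
  case 0
  then show ?case using first_visit_prob_0[OF mc] \<nu> by simp
next
  case (Suc t)
  have "(if x = 0 then 0 else first_visit_prob M X t x * K x y) = 0" for x
  proof (cases "Suc t < x")
    case True
    then show ?thesis by (simp add: Suc.IH)
  next
    case False
    then show ?thesis using jump[of x y] Suc.prems by simp
  qed
  then show ?case using first_visit_prob_Suc[OF mc _ K, of y t] sums_unique2[OF _ sums_zero] by simp
qed

text \<open>Only the shape of column 0 and row 0 of \<Lambda> matters for the transfer, not the
  formula for \<open>mu\<close>. Discarding paths that have met 0 removes index 0 from both
  recursions, and these two shapes make the removals correspond.\<close>

lemma quasi_intertwining_first_visit_prob:
  assumes st: "stochastic_matrix n P" and mc: "markov_chain M {..n} (($) \<pi>) (\<lambda>i j. P $$ (i, j)) X"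
    and mc': "markov_chain M' UNIV \<nu> K X'" and K: "\<And>x y. 0 \<le> K x y"
    and \<nu>: "\<And>y. 1 < y \<Longrightarrow> \<nu> y = 0" and jump: "\<And>x y. Suc x < y \<Longrightarrow> K x y = 0"
    and qi: "quasi_intertwining n \<Lambda> \<pi> (P_abs n P) \<nu> K"
    and \<Lambda>0: "\<Lambda> 0 = unit_vec (Suc n) 0" and \<Lambda>Suc: "\<And>i. i \<noteq> 0 \<Longrightarrow> \<Lambda> i $ 0 = 0"
  shows "first_visit_prob M X t 0 = first_visit_prob M' X' t 0"
proof -
  let ?w = "first_visit_prob M X" and ?v = "first_visit_prob M' X'"
  have P: "P \<in> carrier_mat (Suc n) (Suc n)" using st by (simp add: stochastic_matrix_def)
  have \<Lambda>: "\<Lambda> k \<in> carrier_vec (Suc n)" for k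
    using qi by (simp add: quasi_intertwining_def quasi_link_def)
  have supp: "?v t y = 0" if "Suc t < y" for t y
    using first_visit_prob_finite_support[OF mc' K \<nu> jump that] .
  have v_Suc: "?v (Suc t) y = (\<Sum>k\<in>{1..Suc t}. ?v t k * K k y)" for t y
  proof -
    have "(\<lambda>x. if x = 0 then 0 else ?v t x * K x y) sums (\<Sum>x\<in>{1..Suc t}. if x = 0 then 0 else ?v t x * K x y)"
      by (intro sums_finite) (auto simp: supp)
    then show ?thesis using sums_unique2[OF first_visit_prob_Suc[OF mc' _ K, of y t]] by simp
  qed
  have w_Suc: "?w (Suc t) j = (\<Sum>x\<in>{1..n}. ?w t x * P $$ (x, j))" if "j \<le> n" for t j
  proof -
    have "(\<lambda>x. if x = 0 then 0 else ?w t x * P $$ (x, j)) sums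
        (\<Sum>x\<in>{1..n}. if x = 0 then 0 else ?w t x * P $$ (x, j))"
      by (intro sums_finite) (auto simp: first_visit_prob_outside[OF mc])
    moreover have "(\<lambda>x. if x = 0 then 0 else ?w t x * P $$ (x, j)) sums ?w (Suc t) j"
      using st that by (intro first_visit_prob_Suc[OF mc]) (auto simp: stochastic_matrix_def)
    ultimately show ?thesis using sums_unique2 by fastforce
  qed
  have row: "(\<Sum>l\<le>Suc k. K k l * \<Lambda> l $ j) = (\<Sum>x\<in>{1..n}. \<Lambda> k $ x * P $$ (x, j))"
    if "k \<noteq> 0" "j \<le> n" for k j
  proof -
    have "(\<lambda>l. K k l * \<Lambda> l $ j) sums (\<Sum>l\<le>Suc k. K k l * \<Lambda> l $ j)"
      by (intro sums_finite) (auto simp: jump)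
    moreover have "(\<lambda>l. K k l * \<Lambda> l $ j) sums (row_mult (\<Lambda> k) (P_abs n P) $ j)"
      using qi that unfolding quasi_intertwining_def by blast
    ultimately have "(\<Sum>l\<le>Suc k. K k l * \<Lambda> l $ j) = row_mult (\<Lambda> k) (P_abs n P) $ j"
      by (rule sums_unique2)
    also have "\<dots> = (\<Sum>x\<le>n. \<Lambda> k $ x * P_abs n P $$ (x, j))"
      using that \<Lambda> by (intro row_mult_entry) (auto simp: P_abs_def)
    \<comment> \<open>The factor \<open>\<Lambda> k $ 0\<close> is 0, which deletes row 0, the only
      row where \<open>P_abs\<close> and P may differ.\<close>
    also have "\<dots> = (\<Sum>x\<in>{1..n}. \<Lambda> k $ x * P_abs n P $$ (x, j))"
      using that \<Lambda>Suc by (intro sum.mono_neutral_right) (auto simp: not_le)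
    also have "\<dots> = (\<Sum>x\<in>{1..n}. \<Lambda> k $ x * P $$ (x, j))"
      using that by (intro sum.cong) (auto simp: P_abs_def)
    finally show ?thesis .
  qed
  have main: "?w t j = (\<Sum>k\<le>Suc t. ?v t k * \<Lambda> k $ j)" if "j \<le> n" for j
    using that
  proof (induction t arbitrary: j)
    case 0
    have "(\<lambda>k. \<nu> k * \<Lambda> k $ j) sums (\<Sum>k\<le>Suc 0. \<nu> k * \<Lambda> k $ j)"
      by (intro sums_finite) (auto simp: \<nu>)
    moreover have "(\<lambda>k. \<nu> k * \<Lambda> k $ j) sums (\<pi> $ j)"
      using qi 0 unfolding quasi_intertwining_def by blast
    ultimately have "(\<Sum>k\<le>Suc 0. \<nu> k * \<Lambda> k $ j) = \<pi> $ j"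
      by (rule sums_unique2)
    then show ?case using 0 by (simp add: first_visit_prob_0[OF mc] first_visit_prob_0[OF mc'])
  next
    case (Suc t)
    have "?w (Suc t) j = (\<Sum>x\<in>{1..n}. ?w t x * P $$ (x, j))" using Suc.prems by (rule w_Suc)
    also have "\<dots> = (\<Sum>x\<in>{1..n}. \<Sum>k\<in>{1..Suc t}. ?v t k * (\<Lambda> k $ x * P $$ (x, j)))"
    proof (rule sum.cong[OF refl])
      fix x assume x: "x \<in> {1..n}"
      have "?w t x = (\<Sum>k\<le>Suc t. ?v t k * \<Lambda> k $ x)" using x by (intro Suc.IH) simp
      \<comment> \<open>For x \<ge> 1 the row \<delta>_0 of \<Lambda> vanishes at x, so k = 0 drops
        out, just as it does in \<open>v_Suc\<close>.\<close>
      also have "\<dots> = (\<Sum>k\<in>{1..Suc t}. ?v t k * \<Lambda> k $ x)"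
        using x by (intro sum.mono_neutral_right) (auto simp: not_le \<Lambda>0)
      finally show "?w t x * P $$ (x, j) = (\<Sum>k\<in>{1..Suc t}. ?v t k * (\<Lambda> k $ x * P $$ (x, j)))"
        by (simp only: sum_distrib_right mult.assoc)
    qed
    also have "\<dots> = (\<Sum>k\<in>{1..Suc t}. ?v t k * (\<Sum>x\<in>{1..n}. \<Lambda> k $ x * P $$ (x, j)))"
      by (subst sum.swap) (simp only: sum_distrib_left)
    also have "\<dots> = (\<Sum>k\<in>{1..Suc t}. ?v t k * (\<Sum>l\<le>Suc (Suc t). K k l * \<Lambda> l $ j))"
    proof (rule sum.cong[OF refl])
      fix k assume k: "k \<in> {1..Suc t}"
      \<comment> \<open>The range of l gets a bound independent of k, so that the two sums can be
        swapped.\<close>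
      have "(\<Sum>l\<le>Suc (Suc t). K k l * \<Lambda> l $ j) = (\<Sum>l\<le>Suc k. K k l * \<Lambda> l $ j)"
        using k by (intro sum.mono_neutral_right) (auto simp: jump)
      also have "\<dots> = (\<Sum>x\<in>{1..n}. \<Lambda> k $ x * P $$ (x, j))"
        using k Suc.prems by (intro row) simp_all
      finally show "?v t k * (\<Sum>x\<in>{1..n}. \<Lambda> k $ x * P $$ (x, j))
          = ?v t k * (\<Sum>l\<le>Suc (Suc t). K k l * \<Lambda> l $ j)"
        by (simp only:)
    qed
    also have "\<dots> = (\<Sum>l\<le>Suc (Suc t). \<Sum>k\<in>{1..Suc t}. ?v t k * K k l * \<Lambda> l $ j)"
      by (subst sum.swap) (simp only: sum_distrib_left mult.assoc)
    also have "\<dots> = (\<Sum>l\<le>Suc (Suc t). ?v (Suc t) l * \<Lambda> l $ j)"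
      by (simp only: v_Suc sum_distrib_right)
    finally show ?case .
  qed
  \<comment> \<open>Column 0 of \<Lambda> is 1 at row 0 and 0 elsewhere, so reading the identity
    there isolates the entry at 0.\<close>
  have "?w t 0 = (\<Sum>k\<le>Suc t. ?v t k * \<Lambda> k $ 0)" by (rule main) simp
  also have "\<dots> = (\<Sum>k\<in>{0}. ?v t k * \<Lambda> k $ 0)"
    by (intro sum.mono_neutral_right) (auto simp: \<Lambda>Suc)
  finally show ?thesis by (simp add: \<Lambda>0)
qed

section \<open>The algebra of the intertwining relation\<close>

text \<open>At j = 0 the numerator cancels to 0, so one formula covers every column.\<close>

lemma mu_eq:
  assumes "j \<le> n"
  shows "mu n P \<pi> i $ j = ((P ^\<^sub>m (i - 1)) $$ (0, 0) * \<pi> $ j - \<pi> $ 0 * (P ^\<^sub>m (i - 1)) $$ (0, j))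
       / ((P ^\<^sub>m (i - 1)) $$ (0, 0) - \<pi> $ 0)"
  using assms by (simp add: mu_def)

text \<open>Since \<pi>(0) \<delta>_0 + (1 - \<pi>(0)) \<mu>_1 = \<pi>, row i \<ge> 1 of the
  right-hand product is q_i \<pi> + (1 - q_i) \<mu>_{i+1}. The left-hand side is \<mu>_i P, where
  \<pi> stays fixed and the power of P rises by one. The weight q_i is what matches the two.\<close>

lemma Link_quasi_intertwining:
  assumes st: "stochastic_matrix n P" and stat: "stationary_distribution n P \<pi>"
    and neq: "\<And>t. (P ^\<^sub>m t) $$ (0, 0) \<noteq> \<pi> $ 0"
  shows "quasi_intertwining n (Link n P \<pi>) \<pi> (P_abs n P) (pi_hat \<pi>) (P_hat P \<pi>)"
proof -
  let ?p = "\<pi> $ 0" and ?a = "\<lambda>t. (P ^\<^sub>m t) $$ (0, 0)"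
  have P: "P \<in> carrier_mat (Suc n) (Suc n)" using st by (simp add: stochastic_matrix_def)
  have \<pi>: "(\<Sum>j\<le>n. \<pi> $ j) = 1" using stat by (simp add: stationary_distribution_def)
  have a0: "?a 0 = 1" using P by simp
  \<comment> \<open>The denominator of \<mu>_1 is 1 - \<pi>(0), because P^0(0,0) = 1.\<close>
  then have p1: "?p \<noteq> 1" using neq[of 0] by simp
  have mu1: "mu n P \<pi> (Suc 0) $ j = (\<pi> $ j - ?p * (if j = 0 then 1 else 0)) / (1 - ?p)" if "j \<le> n" for j
    using that P by (simp add: mu_eq)
  have carrier: "Link n P \<pi> i \<in> carrier_vec (Suc n)" for i by (simp add: Link_def mu_def)
  have ql: "quasi_link n (Link n P \<pi>)"
    unfolding quasi_link_def
  proof (intro allI conjI carrier)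
    fix i
    show "(\<Sum>j\<le>n. Link n P \<pi> i $ j) = 1"
    proof (cases i)
      case 0
      have "(\<Sum>j\<le>n. Link n P \<pi> i $ j) = (\<Sum>j\<le>n. if j = 0 then 1 else 0)"
        using 0 by (intro sum.cong) (auto simp: Link_def)
      then show ?thesis by simp
    next
      case (Suc t)
      have "(\<Sum>j\<le>n. Link n P \<pi> i $ j)
          = (\<Sum>j\<le>n. (?a t * \<pi> $ j - ?p * (P ^\<^sub>m t) $$ (0, j)) / (?a t - ?p))"
        using Suc by (intro sum.cong) (auto simp: Link_def mu_eq)
      also have "\<dots> = (?a t * (\<Sum>j\<le>n. \<pi> $ j) - ?p * (\<Sum>j\<le>n. (P ^\<^sub>m t) $$ (0, j))) / (?a t - ?p)"
        by (simp add: sum_divide_distrib[symmetric] sum_subtractf sum_distrib_left)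
      also have "(\<Sum>j\<le>n. (P ^\<^sub>m t) $$ (0, j)) = 1"
        using stochastic_matrix_pow[OF st, of t] by (simp add: stochastic_matrix_def)
      finally show ?thesis using neq[of t] \<pi> by simp
    qed
  qed
  have step: "(\<lambda>k. P_hat P \<pi> i k * Link n P \<pi> k $ j) sums (row_mult (Link n P \<pi> i) (P_abs n P) $ j)"
    if j: "j \<le> n" for i j
  proof -
    have rm: "row_mult (Link n P \<pi> i) (P_abs n P) $ j = (\<Sum>k\<le>n. Link n P \<pi> i $ k * P_abs n P $$ (k, j))"
      using carrier j by (intro row_mult_entry) (auto simp: P_abs_def)
    show ?thesis
    proof (cases i)
      case 0
      have "(\<Sum>k\<le>n. Link n P \<pi> i $ k * P_abs n P $$ (k, j)) = (\<Sum>k\<le>n. if k = 0 then P_abs n P $$ (0, j) else 0)"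
        using 0 by (intro sum.cong) (auto simp: Link_def)
      also have "\<dots> = unit_vec (Suc n) 0 $ j" using j by (simp add: P_abs_def)
      finally have "row_mult (Link n P \<pi> i) (P_abs n P) $ j = (\<Sum>k\<in>{0}. P_hat P \<pi> i k * Link n P \<pi> k $ j)"
        using rm 0 by (simp add: P_hat_def Link_def)
      moreover have "(\<lambda>k. P_hat P \<pi> i k * Link n P \<pi> k $ j) sums (\<Sum>k\<in>{0}. P_hat P \<pi> i k * Link n P \<pi> k $ j)"
        using 0 by (intro sums_finite) (auto simp: P_hat_def)
      ultimately show ?thesis by simp
    next
      case (Suc t)
      have "(\<Sum>k\<le>n. Link n P \<pi> i $ k * P_abs n P $$ (k, j))
          = (\<Sum>k\<le>n. (?a t * (\<pi> $ k * P $$ (k, j)) - ?p * ((P ^\<^sub>m t) $$ (0, k) * P $$ (k, j))) / (?a t - ?p))"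
      proof (rule sum.cong[OF refl])
        fix k assume "k \<in> {..n}"
        then show "Link n P \<pi> i $ k * P_abs n P $$ (k, j)
          = (?a t * (\<pi> $ k * P $$ (k, j)) - ?p * ((P ^\<^sub>m t) $$ (0, k) * P $$ (k, j))) / (?a t - ?p)"
          using Suc j by (cases "k = 0") (auto simp: Link_def mu_eq P_abs_def algebra_simps)
      qed
      also have "\<dots> = (?a t * (\<Sum>k\<le>n. \<pi> $ k * P $$ (k, j)) - ?p * (\<Sum>k\<le>n. (P ^\<^sub>m t) $$ (0, k) * P $$ (k, j))) / (?a t - ?p)"
        by (simp add: sum_divide_distrib[symmetric] sum_subtractf sum_distrib_left)
      also have "(\<Sum>k\<le>n. \<pi> $ k * P $$ (k, j)) = \<pi> $ j"
        using stationary_pow[OF P stat j, of 1] P by simp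
      also have "(\<Sum>k\<le>n. (P ^\<^sub>m t) $$ (0, k) * P $$ (k, j)) = (P ^\<^sub>m Suc t) $$ (0, j)"
        using j by (intro pow_mat_Suc_entry[OF P, symmetric]) auto
      finally have lhs: "row_mult (Link n P \<pi> i) (P_abs n P) $ j
          = (?a t * \<pi> $ j - ?p * (P ^\<^sub>m Suc t) $$ (0, j)) / (?a t - ?p)"
        using rm by simp
      \<comment> \<open>Consecutive gaps above \<pi>(0): 1 - q_i = c / b, and c is the denominator
        of \<mu>_{i+1}, so it cancels and leaves the denominator b of \<mu>_i.\<close>
      define b c where "b = ?a t - ?p" and "c = ?a (Suc t) - ?p"
      have nz: "b \<noteq> 0" "c \<noteq> 0" using neq[of t] neq[of "Suc t"] by (simp_all add: b_def c_def del: pow_mat.simps)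
      have at: "?a t = b + ?p" "?a (Suc t) = c + ?p" by (simp_all add: b_def c_def)
      have q: "q P \<pi> (Suc t) = (b - c) / b"
        by (simp add: q_def b_def c_def del: pow_mat.simps)
      have mu2: "mu n P \<pi> (Suc (Suc t)) $ j = ((c + ?p) * \<pi> $ j - ?p * (P ^\<^sub>m Suc t) $$ (0, j)) / c"
        using j at by (simp add: mu_eq del: pow_mat.simps)
      have "(\<Sum>k\<in>{0, 1, Suc i}. P_hat P \<pi> i k * Link n P \<pi> k $ j)
          = ?p * q P \<pi> i * (if j = 0 then 1 else 0) + (1 - ?p) * q P \<pi> i * mu n P \<pi> (Suc 0) $ j
            + (1 - q P \<pi> i) * mu n P \<pi> (Suc i) $ j"
        using Suc j by (simp add: P_hat_def Link_def)
      also have "\<dots> = q P \<pi> i * \<pi> $ j + (1 - q P \<pi> i) * mu n P \<pi> (Suc i) $ j"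
        using p1 by (simp add: mu1[OF j] field_simps)
      also have "1 - q P \<pi> i = c / b" using nz Suc q by (simp add: field_simps)
      also have "q P \<pi> i * \<pi> $ j + c / b * mu n P \<pi> (Suc i) $ j
          = (?a t * \<pi> $ j - ?p * (P ^\<^sub>m Suc t) $$ (0, j)) / (?a t - ?p)"
        using nz unfolding Suc q mu2 at(1) by (simp add: field_simps del: pow_mat.simps)
      finally have "row_mult (Link n P \<pi> i) (P_abs n P) $ j = (\<Sum>k\<in>{0, 1, Suc i}. P_hat P \<pi> i k * Link n P \<pi> k $ j)"
        using lhs by simp
      moreover have "(\<lambda>k. P_hat P \<pi> i k * Link n P \<pi> k $ j) sums (\<Sum>k\<in>{0, 1, Suc i}. P_hat P \<pi> i k * Link n P \<pi> k $ j)"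
        using Suc by (intro sums_finite) (auto simp: P_hat_def)
      ultimately show ?thesis by simp
    qed
  qed
  have init: "(\<lambda>k. pi_hat \<pi> k * Link n P \<pi> k $ j) sums (\<pi> $ j)" if j: "j \<le> n" for j
  proof -
    have "(\<lambda>k. pi_hat \<pi> k * Link n P \<pi> k $ j) sums (\<Sum>k\<in>{0, 1}. pi_hat \<pi> k * Link n P \<pi> k $ j)"
      by (intro sums_finite) (auto simp: pi_hat_def)
    also have "(\<Sum>k\<in>{0, 1}. pi_hat \<pi> k * Link n P \<pi> k $ j) = \<pi> $ j"
      using j p1 by (simp add: pi_hat_def Link_def mu1)
    finally show ?thesis .
  qed
  show ?thesis unfolding quasi_intertwining_def using ql step init by blast
qed

text \<open>\<open>well_defined\<close> keeps the denominators of \<open>mu\<close> and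
  \<open>q\<close> nonzero; it excludes n = 0, where P^t(0,0) = \<pi>(0) = 1. The two chains may
  live on different probability spaces, since only their laws are compared.\<close>

theorem theorem4p5:
  fixes n :: nat and P :: "real mat" and \<pi> :: "real vec"
    and M :: "'a measure" and X :: "nat \<Rightarrow> 'a \<Rightarrow> nat"
    and M' :: "'b measure" and X' :: "nat \<Rightarrow> 'b \<Rightarrow> nat"
  assumes ergodic: "ergodic_matrix n P"
    and stationary: "stationary_distribution n P \<pi>"
    and nonincreasing: "decseq (\<lambda>t. (P ^\<^sub>m t) $$ (0, 0))"
    and well_defined: "\<And>t. (P ^\<^sub>m t) $$ (0, 0) \<noteq> \<pi> $ 0"
  shows "(\<forall>i\<ge>1. q P \<pi> i \<in> {0..<1}) \<and>
    quasi_intertwining n (Link n P \<pi>) \<pi> (P_abs n P) (pi_hat \<pi>) (P_hat P \<pi>) \<and>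
    Link n P \<pi> 0 $ 0 = 1 \<and> (\<forall>i\<ge>1. Link n P \<pi> i $ 0 = 0) \<and>
    (markov_chain M {..n} (\<lambda>i. \<pi> $ i) (\<lambda>i j. P $$ (i, j)) X \<longrightarrow>
     markov_chain M' UNIV (pi_hat \<pi>) (P_hat P \<pi>) X' \<longrightarrow>
     distr M (count_space UNIV) (hitting_time X) = distr M' (count_space UNIV) (hitting_time X'))"
proof -
  have st: "stochastic_matrix n P" and irr: "irreducible_matrix n P"
    using ergodic by (simp_all add: ergodic_matrix_def)
  \<comment> \<open>The weak bound and \<open>well_defined\<close> give a strict one, so all
    denominators are positive.\<close>
  have less: "\<pi> $ 0 < (P ^\<^sub>m t) $$ (0, 0)" for t
    using stationary_le_return_prob[OF st irr stationary nonincreasing, of t] well_defined[of t] by simp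
  \<comment> \<open>Monotonicity makes the numerator nonnegative, and P^i(0,0) > \<pi>(0) makes it
    smaller than the denominator.\<close>
  have q: "q P \<pi> i \<in> {0..<1}" if "i \<ge> 1" for i
    using less[of "i - 1"] less[of i] decseqD[OF nonincreasing, of "i - 1" i]
    by (auto simp: q_def field_simps)
  have qi: "quasi_intertwining n (Link n P \<pi>) \<pi> (P_abs n P) (pi_hat \<pi>) (P_hat P \<pi>)"
    using st stationary well_defined by (rule Link_quasi_intertwining)
  have L0: "Link n P \<pi> 0 = unit_vec (Suc n) 0" by (simp add: Link_def)
  have LSuc: "Link n P \<pi> i $ 0 = 0" if "i \<noteq> 0" for i using that by (simp add: Link_def mu_def)
  have "0 \<le> \<pi> $ 0" using stationary by (simp add: stationary_distribution_def)
  moreover have "\<pi> $ 0 < 1"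
    using less[of 0] st by (auto simp: stochastic_matrix_def)
  \<comment> \<open>The transfer lemma asks for a nonnegative kernel. This is where the range of q
    and the bounds 0 \<le> \<pi>(0) < 1 are used.\<close>
  ultimately have K: "0 \<le> P_hat P \<pi> x y" for x y
    using q[of x] by (cases x) (auto simp: P_hat_def)
  have "distr M (count_space UNIV) (hitting_time X) = distr M' (count_space UNIV) (hitting_time X')"
    if mc: "markov_chain M {..n} (\<lambda>i. \<pi> $ i) (\<lambda>i j. P $$ (i, j)) X"
      and mc': "markov_chain M' UNIV (pi_hat \<pi>) (P_hat P \<pi>) X'"
  proof (rule distr_hitting_time_eq)
    show "prob_space M" "prob_space M'" "\<And>t. X' t \<in> measurable M' (count_space UNIV)"
      using mc mc' by (simp_all add: markov_chain_def)
    have "X t \<in> measurable M (count_space {..n})" for t using mc by (simp add: markov_chain_def)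
    from measurable_compose[OF this, of "\<lambda>x. x" "count_space UNIV"]
    show "X t \<in> measurable M (count_space UNIV)" for t by simp
    show "first_visit_prob M X t 0 = first_visit_prob M' X' t 0" for t
      using st mc mc' K _ _ qi L0 LSuc
      by (rule quasi_intertwining_first_visit_prob) (auto simp: pi_hat_def P_hat_def)
  qed
  with q qi L0 LSuc show ?thesis by auto
qed

end
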